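(* (1) The action of the Lie subgroup $\mathrm{SU}(2)\subset\mathrm{GL}^+(2,\mathbb{C})$ on the Lie group $\mathrm{GL}^+(2,\mathbb{C})$ by conjugations is a subgroup of the group of inner automorphisms of $\mathrm{GL}^+(2,\mathbb{C})$ and defines a subgroup of isometries with respect to the left-invariant sub-Lorentzian (anti)metric $d$ on $\mathrm{GL}^+(2,\mathbb{C})$ defined by the pair $(H,\langle\cdot,\cdot\rangle)$. (2) The adjoint action $\mathrm{Ad}(\mathrm{SU}(2))$ of the group $\mathrm{SU}(2)$ on the Lie algebra $\mathfrak{gl}^+(2,\mathbb{C})$ defines a subgroup of automorphisms of this algebra, transforming $H$ and $\mathfrak{su}(2)$ into themselves, and a subgroup of isometries of the space $(H,\langle\cdot,\cdot\rangle)$, acting transitively on $\{w\in H_0\mid\langle w,w\rangle=-1\}$.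
   Context: $\mathrm{GL}^+(2,\mathbb{C})$ is the Lie group of complex $2\times2$ matrices with positive real determinant; its Lie algebra $\mathfrak{gl}^+(2,\mathbb{C})$ consists of complex $2\times2$ matrices with real trace. Let $e_0=\frac12 I$, $e_1=\frac12\begin{pmatrix}0&1\\1&0\end{pmatrix}$, $e_2=\frac12\begin{pmatrix}0&\mathbf{i}\\-\mathbf{i}&0\end{pmatrix}$, $e_3=\frac12\begin{pmatrix}1&0\\0&-1\end{pmatrix}$. $H=\mathrm{span}_{\mathbb{R}}(e_0,\dots,e_3)$ is the space of Hermitian matrices, with pseudoscalar product $\langle\cdot,\cdot\rangle$ whose quadratic form is $\langle h,h\rangle=h_0^2-h_1^2-h_2^2-h_3^2=4\det h$ for $h=\sum h_ie_i$; $H_0=\mathrm{span}_{\mathbb{R}}(e_1,e_2,e_3)$ is the space of traceless Hermitian matrices. $l_g:h\mapsto gh$ is the left shift. A horizontal curve is a Lipschitzian curve with $g'(t)=dl_{g(t)}(u(t))$, $u(t)\in H$ for almost all $t$; it is nonspacelike if $\langle u(t),u(t)\rangle\ge0$ and future directed if $\langle u(t),e_0\rangle>0$ for almost all $t$. $d(x,y)$ is the supremum of lengths $\int\sqrt{\langle u,u\rangle}\,dt$ of future directed nonspacelike horizontal curves from $x$ to $y$ ($-\infty$ if there are none). An isometry with respect to $d$ is a bijection preserving $d$. *)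

theory Defs
  imports "HOL-Analysis.Analysis" "HOL-Algebra.Bij" "HOL-Algebra.Group_Action"
begin

type_synonym cmat2 = "complex ^ 2 ^ 2"

definition cmat2 :: "complex \<Rightarrow> complex \<Rightarrow> complex \<Rightarrow> complex \<Rightarrow> cmat2" where
  "cmat2 a b c d = vector [vector [a, b], vector [c, d]]"

lemma cmat2_nth [simp]:
  "cmat2 a b c d $ 1 $ 1 = a" "cmat2 a b c d $ 1 $ 2 = b"
  "cmat2 a b c d $ 2 $ 1 = c" "cmat2 a b c d $ 2 $ 2 = d"
  by (simp_all add: cmat2_def)

lemma cmat2_eq_iff:
  fixes A B :: cmat2
  shows "A = B \<longleftrightarrow> A$1$1 = B$1$1 \<and> A$1$2 = B$1$2 \<and> A$2$1 = B$2$1 \<and> A$2$2 = B$2$2"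
  by (auto simp: vec_eq_iff forall_2)

definition conj_transpose :: "cmat2 \<Rightarrow> cmat2" where
  "conj_transpose A = map_matrix cnj (transpose A)"


subsection \<open>The groups and their Lie algebras\<close>

definition GLplus :: "cmat2 monoid" where
  "GLplus = \<lparr>carrier = {A. det A \<in> \<real> \<and> Re (det A) > 0}, mult = (**), one = mat 1\<rparr>"

definition SU2 :: "cmat2 set" where
  "SU2 = {A. conj_transpose A ** A = mat 1 \<and> det A = 1}"

definition SU2_group :: "cmat2 monoid" where
  "SU2_group = GLplus\<lparr>carrier := SU2\<rparr>"

definition glplus :: "cmat2 set" where
  "glplus = {X. trace X \<in> \<real>}"

definition su2 :: "cmat2 set" where
  "su2 = {X. conj_transpose X = - X \<and> trace X = 0}"

definition lie_bracket :: "cmat2 \<Rightarrow> cmat2 \<Rightarrow> cmat2" where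
  "lie_bracket X Y = X ** Y - Y ** X"


subsection \<open>Hermitian matrices and the pseudoscalar product\<close>

definition e0 :: cmat2 where "e0 = (1/2) *\<^sub>R mat 1"
definition e1 :: cmat2 where "e1 = (1/2) *\<^sub>R cmat2 0 1 1 0"
definition e2 :: cmat2 where "e2 = (1/2) *\<^sub>R cmat2 0 \<i> (- \<i>) 0"
definition e3 :: cmat2 where "e3 = (1/2) *\<^sub>R cmat2 1 0 0 (- 1)"

text \<open>Both spans are over the reals.\<close>

definition H :: "cmat2 set" where "H = span {e0, e1, e2, e3}"

definition H0 :: "cmat2 set" where "H0 = span {e1, e2, e3}"

definition coord :: "cmat2 \<Rightarrow> cmat2 \<Rightarrow> real" where
  "coord h e = representation {e0, e1, e2, e3} h e"

text \<open>The product is meaningful on \<^const>\<open>H\<close> only; elsewhere all the coordinates are 0.\<close>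

definition pairing :: "cmat2 \<Rightarrow> cmat2 \<Rightarrow> real" where
  "pairing h k =
     coord h e0 * coord k e0 - coord h e1 * coord k e1
     - coord h e2 * coord k e2 - coord h e3 * coord k e3"


subsection \<open>The sub-Lorentzian antimetric\<close>

text \<open>
  The left shift by \<open>g\<close> is the restriction of a linear map, so that its differential sends
  \<open>u\<close> to \<open>g ** u\<close>. The image of a curve is compact in the group, whence it is Lipschitz for
  the norm of matrices iff it is Lipschitz for any Riemannian metric on the group.
\<close>

definition horizontal_curve ::
  "real \<Rightarrow> real \<Rightarrow> (real \<Rightarrow> cmat2) \<Rightarrow> (real \<Rightarrow> cmat2) \<Rightarrow> bool" where
  "horizontal_curve a b g u \<longleftrightarrow>
     a < b \<and> g ` {a..b} \<subseteq> carrier GLplus \<and> (\<exists>C. C-lipschitz_on {a..b} g) \<and>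
     (AE t\<in>{a..b} in lebesgue.
        (g has_vector_derivative g t ** u t) (at t within {a..b}) \<and> u t \<in> H)"

definition nonspacelike :: "real \<Rightarrow> real \<Rightarrow> (real \<Rightarrow> cmat2) \<Rightarrow> bool" where
  "nonspacelike a b u \<longleftrightarrow> (AE t\<in>{a..b} in lebesgue. pairing (u t) (u t) \<ge> 0)"

definition future_directed :: "real \<Rightarrow> real \<Rightarrow> (real \<Rightarrow> cmat2) \<Rightarrow> bool" where
  "future_directed a b u \<longleftrightarrow> (AE t\<in>{a..b} in lebesgue. pairing (u t) e0 > 0)"

definition curve_length :: "real \<Rightarrow> real \<Rightarrow> (real \<Rightarrow> cmat2) \<Rightarrow> real" where
  "curve_length a b u = (LINT t:{a..b}|lebesgue. sqrt (pairing (u t) (u t)))"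

text \<open>The supremum of the empty set in \<^typ>\<open>ereal\<close> is \<open>-\<infinity>\<close>.\<close>

definition antimetric :: "cmat2 \<Rightarrow> cmat2 \<Rightarrow> ereal" where
  "antimetric x y = Sup {ereal (curve_length a b u) | a b g u.
     horizontal_curve a b g u \<and> nonspacelike a b u \<and> future_directed a b u \<and>
     g a = x \<and> g b = y}"


subsection \<open>Groups of automorphisms and of isometries\<close>

definition conjugation :: "('a, 'b) monoid_scheme \<Rightarrow> 'a \<Rightarrow> 'a \<Rightarrow> 'a" where
  "conjugation G g = (\<lambda>x\<in>carrier G. g \<otimes>\<^bsub>G\<^esub> x \<otimes>\<^bsub>G\<^esub> inv\<^bsub>G\<^esub> g)"

definition InnGroup :: "('a, 'b) monoid_scheme \<Rightarrow> ('a \<Rightarrow> 'a) monoid" where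
  "InnGroup G = AutoGroup G \<lparr>carrier := conjugation G ` carrier G\<rparr>"

definition IsomGroup :: "('a, 'b) monoid_scheme \<Rightarrow> ('a \<Rightarrow> 'a \<Rightarrow> ereal) \<Rightarrow> ('a \<Rightarrow> 'a) monoid" where
  "IsomGroup G d = BijGroup (carrier G)
     \<lparr>carrier := {f \<in> Bij (carrier G). \<forall>x\<in>carrier G. \<forall>y\<in>carrier G. d (f x) (f y) = d x y}\<rparr>"

definition Ad :: "cmat2 \<Rightarrow> cmat2 \<Rightarrow> cmat2" where
  "Ad s = (\<lambda>X\<in>glplus. s ** X ** matrix_inv s)"

definition linear_bijections :: "cmat2 set \<Rightarrow> (cmat2 \<Rightarrow> cmat2) set" where
  "linear_bijections V =
     {f \<in> Bij V. (\<forall>x\<in>V. \<forall>y\<in>V. f (x + y) = f x + f y) \<and> (\<forall>c. \<forall>x\<in>V. f (c *\<^sub>R x) = c *\<^sub>R f x)}"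

definition LieAutGroup :: "(cmat2 \<Rightarrow> cmat2) monoid" where
  "LieAutGroup = BijGroup glplus
     \<lparr>carrier := {f \<in> linear_bijections glplus.
        \<forall>X\<in>glplus. \<forall>Y\<in>glplus. f (lie_bracket X Y) = lie_bracket (f X) (f Y)}\<rparr>"

definition HIsomGroup :: "(cmat2 \<Rightarrow> cmat2) monoid" where
  "HIsomGroup = BijGroup H
     \<lparr>carrier := {f \<in> linear_bijections H. \<forall>h\<in>H. \<forall>k\<in>H. pairing (f h) (f k) = pairing h k}\<rparr>"

definition unit_spacelike :: "cmat2 set" where
  "unit_spacelike = {w \<in> H0. pairing w w = -1}"


subsection \<open>Basic facts\<close>

lemma matrix_mult_2:
  fixes A B :: cmat2
  shows "(A ** B) $ i $ j = A$i$1 * B$1$j + A$i$2 * B$2$j"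
  by (simp add: matrix_matrix_mult_def sum_2)

lemma group_GLplus: "group GLplus"
proof (rule groupI)
  fix x assume "x \<in> carrier GLplus"
  then have x: "det x \<in> \<real>" "Re (det x) > 0" by (auto simp: GLplus_def)
  then have "invertible x" by (auto simp: invertible_det_nz)
  then obtain y where y: "y ** x = mat 1" by (auto simp: invertible_def)
  then have "det y * det x = 1" by (metis det_I det_mul)
  moreover have "det x \<noteq> 0" using x by auto
  ultimately have d: "det y = inverse (det x)" by (simp add: field_simps)
  obtain r where r: "det x = of_real r" using x(1) by (auto elim: Reals_cases)
  have "y \<in> carrier GLplus"
    using x d unfolding r GLplus_def by (simp flip: of_real_inverse)
  then show "\<exists>y\<in>carrier GLplus. y \<otimes>\<^bsub>GLplus\<^esub> x = \<one>\<^bsub>GLplus\<^esub>"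
    using y by (auto simp: GLplus_def)
next
  fix x y assume "x \<in> carrier GLplus" "y \<in> carrier GLplus"
  then show "x \<otimes>\<^bsub>GLplus\<^esub> y \<in> carrier GLplus"
    by (auto simp: GLplus_def det_mul elim!: Reals_cases)
qed (auto simp: GLplus_def matrix_mul_assoc)

lemma inv_GLplus:
  assumes "x \<in> carrier GLplus" shows "inv\<^bsub>GLplus\<^esub> x = matrix_inv x"
proof -
  interpret group GLplus by (rule group_GLplus)
  have "invertible x" using assms by (auto simp: invertible_det_nz GLplus_def)
  then have m: "matrix_inv x ** x = mat 1"
    unfolding matrix_inv_def invertible_def by (rule someI2_ex) auto
  moreover have "inv\<^bsub>GLplus\<^esub> x ** x = mat 1" "x ** inv\<^bsub>GLplus\<^esub> x = mat 1"
    using l_inv[OF assms] r_inv[OF assms] by (auto simp: GLplus_def)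
  ultimately show ?thesis by (metis matrix_mul_assoc matrix_mul_lid matrix_mul_rid)
qed

lemma conj_transpose_nth [simp]: "conj_transpose A $ i $ j = cnj (A $ j $ i)"
  by (simp add: conj_transpose_def transpose_def)

lemma conj_transpose_mult: "conj_transpose (A ** B) = conj_transpose B ** conj_transpose A"
  by (simp add: cmat2_eq_iff matrix_mult_2 mult.commute)

lemma matrix_inv_SU2:
  assumes "s \<in> SU2" shows "matrix_inv s = conj_transpose s"
proof -
  have l: "conj_transpose s ** s = mat 1" using assms by (simp add: SU2_def)
  then have "s ** conj_transpose s = mat 1" by (rule matrix_left_right_inverse[THEN iffD1])
  with l have "invertible s" by (auto simp: invertible_def)
  then have "matrix_inv s ** s = mat 1"
    unfolding matrix_inv_def invertible_def by (rule someI2_ex) auto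
  with \<open>s ** conj_transpose s = mat 1\<close> show ?thesis
    by (metis matrix_mul_assoc matrix_mul_lid matrix_mul_rid)
qed

lemma subgroup_SU2: "subgroup SU2 GLplus"
proof (rule group.subgroupI[OF group_GLplus])
  show sub: "SU2 \<subseteq> carrier GLplus" by (auto simp: SU2_def GLplus_def)
  show "SU2 \<noteq> {}"
  proof -
    have "mat 1 \<in> SU2" by (simp add: SU2_def cmat2_eq_iff matrix_mult_2 det_2) (simp add: mat_def)
    then show ?thesis by auto
  qed
  show "inv\<^bsub>GLplus\<^esub> a \<in> SU2" if "a \<in> SU2" for a
  proof -
    have u: "conj_transpose a ** a = mat 1" "det a = 1" using that by (auto simp: SU2_def)
    have "det (conj_transpose a) * det a = 1" using u(1) by (metis det_I det_mul)
    moreover have "a ** conj_transpose a = mat 1" using u(1) by (rule matrix_left_right_inverse[THEN iffD1])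
    moreover have "conj_transpose (conj_transpose a) = a" by (simp add: cmat2_eq_iff)
    ultimately have "conj_transpose a \<in> SU2" using u by (simp add: SU2_def)
    then show ?thesis using that sub by (simp add: inv_GLplus matrix_inv_SU2 subset_iff)
  qed
  show "a \<otimes>\<^bsub>GLplus\<^esub> b \<in> SU2" if "a \<in> SU2" "b \<in> SU2" for a b
  proof -
    have "conj_transpose (a ** b) ** (a ** b)
        = conj_transpose b ** (conj_transpose a ** a) ** b"
      by (simp only: conj_transpose_mult matrix_mul_assoc)
    then show ?thesis using that by (simp add: SU2_def GLplus_def det_mul)
  qed
qed

lemma group_SU2: "group SU2_group"
  unfolding SU2_group_def by (rule group.subgroup_imp_group[OF group_GLplus subgroup_SU2])

lemma Ad_has_derivative:
  "((\<lambda>x. s ** x ** matrix_inv s) has_derivative (\<lambda>X. s ** X ** matrix_inv s)) (at (mat 1))"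
  for s :: cmat2
proof -
  have "linear (\<lambda>x. s ** x ** matrix_inv s)"
    by (rule linearI) (simp_all add: cmat2_eq_iff matrix_mult_2 algebra_simps)
  then show ?thesis using linear_imp_has_derivative by blast
qed

lemma (in group) conjugation_hom: "conjugation G \<in> hom G (AutoGroup G)"
proof (rule homI)
  have closed: "conjugation G g x \<in> carrier G" if "g \<in> carrier G" "x \<in> carrier G" for g x
    using that by (simp add: conjugation_def)
  have cancel: "conjugation G g (conjugation G (inv g) x) = x"
    "conjugation G (inv g) (conjugation G g x) = x"
    if "g \<in> carrier G" "x \<in> carrier G" for g x
    using that by (simp_all add: conjugation_def m_assoc inv_solve_left' flip: inv_mult_group)
      (simp_all add: m_assoc[symmetric])
  show auto: "conjugation G g \<in> carrier (AutoGroup G)" if g: "g \<in> carrier G" for g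
  proof -
    have "bij_betw (conjugation G g) (carrier G) (carrier G)"
      using g cancel closed by (intro bij_betwI[where g = "conjugation G (inv g)"]) auto
    moreover have "conjugation G g \<in> hom G G"
    proof (rule homI)
      fix x y assume x: "x \<in> carrier G" and y: "y \<in> carrier G"
      have "g \<otimes> x \<otimes> inv g \<otimes> (g \<otimes> y \<otimes> inv g) = g \<otimes> x \<otimes> (inv g \<otimes> g) \<otimes> y \<otimes> inv g"
        using g x y by (simp only: m_assoc m_closed inv_closed)
      then show "conjugation G g (x \<otimes> y) = conjugation G g x \<otimes> conjugation G g y"
        using g x y by (simp add: conjugation_def m_assoc)
    qed (use g closed in auto)
    ultimately show ?thesis
      by (simp add: AutoGroup_def auto_def Bij_def conjugation_def)
  qed
  fix g h assume g: "g \<in> carrier G" and h: "h \<in> carrier G"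
  have "conjugation G (g \<otimes> h) = compose (carrier G) (conjugation G g) (conjugation G h)"
    using g h by (auto simp: conjugation_def compose_def fun_eq_iff m_assoc inv_mult_group)
  then show "conjugation G (g \<otimes> h) = conjugation G g \<otimes>\<^bsub>AutoGroup G\<^esub> conjugation G h"
    using auto[OF g] auto[OF h] by (simp add: AutoGroup_def BijGroup_def auto_def)
qed

lemma (in group) group_InnGroup: "group (InnGroup G)"
proof -
  interpret group_hom G "AutoGroup G" "conjugation G"
    by (simp add: group_hom_def group_hom_axioms_def conjugation_hom AutoGroup)
  show ?thesis
    unfolding InnGroup_def
    by (rule group.subgroup_imp_group[OF H.is_group img_is_subgroup])
qed

lemma subgroup_isometries:
  "subgroup {f \<in> Bij S. \<forall>x\<in>S. \<forall>y\<in>S. d (f x) (f y) = d x y} (BijGroup S)"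
proof (rule group.subgroupI[OF group_BijGroup])
  show "inv\<^bsub>BijGroup S\<^esub> f \<in> {f \<in> Bij S. \<forall>x\<in>S. \<forall>y\<in>S. d (f x) (f y) = d x y}"
    if "f \<in> {f \<in> Bij S. \<forall>x\<in>S. \<forall>y\<in>S. d (f x) (f y) = d x y}" for f
  proof -
    have f: "f \<in> Bij S" and d: "\<And>x y. x \<in> S \<Longrightarrow> y \<in> S \<Longrightarrow> d (f x) (f y) = d x y"
      using that by auto
    have i: "inv_into S f x \<in> S" "f (inv_into S f x) = x" if "x \<in> S" for x
      using f that by (auto simp: Bij_def bij_betw_def inv_into_into f_inv_into_f)
    show ?thesis
      using f d[OF i(1) i(1)] i by (auto simp: inv_BijGroup restrict_inv_into_Bij)
  qed
  show "{f \<in> Bij S. \<forall>x\<in>S. \<forall>y\<in>S. d (f x) (f y) = d x y} \<noteq> {}"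
    using id_Bij[of S] by (auto intro!: exI[of _ "\<lambda>x\<in>S. x"])
  show "f \<otimes>\<^bsub>BijGroup S\<^esub> g \<in> {f \<in> Bij S. \<forall>x\<in>S. \<forall>y\<in>S. d (f x) (f y) = d x y}"
    if "f \<in> {f \<in> Bij S. \<forall>x\<in>S. \<forall>y\<in>S. d (f x) (f y) = d x y}"
      "g \<in> {f \<in> Bij S. \<forall>x\<in>S. \<forall>y\<in>S. d (f x) (f y) = d x y}" for f g
    using that compose_Bij[of f S g] Bij_imp_funcset[of g S]
    by (auto simp: BijGroup_def compose_eq Pi_iff)
qed (auto simp: BijGroup_def)

lemma group_IsomGroup: "group (IsomGroup G d)"
  unfolding IsomGroup_def by (rule group.subgroup_imp_group[OF group_BijGroup subgroup_isometries])

lemma H_basis: "independent {e0, e1, e2, e3}"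
  and e_distinct: "distinct [e0, e1, e2, e3]"
proof -
  show d: "distinct [e0, e1, e2, e3]"
    by (simp add: e0_def e1_def e2_def e3_def cmat2_eq_iff mat_def complex_eq_iff)
  show "independent {e0, e1, e2, e3}"
  proof (rule independent_if_scalars_zero)
    fix f x assume z: "(\<Sum>x\<in>{e0, e1, e2, e3}. f x *\<^sub>R x) = 0" and x: "x \<in> {e0, e1, e2, e3}"
    have "f e0 *\<^sub>R e0 + f e1 *\<^sub>R e1 + f e2 *\<^sub>R e2 + f e3 *\<^sub>R e3 = 0"
      using z d by (simp add: add.assoc)
    then have "f e0 = 0 \<and> f e1 = 0 \<and> f e2 = 0 \<and> f e3 = 0"
      by (simp add: e0_def e1_def e2_def e3_def cmat2_eq_iff mat_def complex_eq_iff)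
    then show "f x = 0" using x by auto
  qed simp
qed

lemma coord_sum:
  assumes "h = a *\<^sub>R e0 + b *\<^sub>R e1 + c *\<^sub>R e2 + d *\<^sub>R e3"
  shows "coord h e0 = a" "coord h e1 = b" "coord h e2 = c" "coord h e3 = d"
proof -
  have s: "e0 \<in> span {e0, e1, e2, e3}" "e1 \<in> span {e0, e1, e2, e3}"
    "e2 \<in> span {e0, e1, e2, e3}" "e3 \<in> span {e0, e1, e2, e3}"
    by (auto intro: span_base)
  have "coord h v = a * (if v = e0 then 1 else 0) + b * (if v = e1 then 1 else 0)
      + c * (if v = e2 then 1 else 0) + d * (if v = e3 then 1 else 0)" for v
    unfolding coord_def assms using H_basis s
    by (simp add: representation_add representation_scale span_add span_scale representation_basis)
  then show "coord h e0 = a" "coord h e1 = b" "coord h e2 = c" "coord h e3 = d"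
    using e_distinct by auto
qed

lemma H_sum:
  "h \<in> H \<longleftrightarrow> (\<exists>a b c d. h = a *\<^sub>R e0 + b *\<^sub>R e1 + c *\<^sub>R e2 + d *\<^sub>R e3)"
proof
  assume "h \<in> H"
  then obtain a b c d where "h - a *\<^sub>R e0 - b *\<^sub>R e1 - c *\<^sub>R e2 - d *\<^sub>R e3 = 0"
    unfolding H_def by (auto simp: span_insert)
  then have "h = a *\<^sub>R e0 + b *\<^sub>R e1 + c *\<^sub>R e2 + d *\<^sub>R e3"
    by (simp add: algebra_simps)
  then show "\<exists>a b c d. h = a *\<^sub>R e0 + b *\<^sub>R e1 + c *\<^sub>R e2 + d *\<^sub>R e3" by blast
next
  have "e0 \<in> H" "e1 \<in> H" "e2 \<in> H" "e3 \<in> H"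
    unfolding H_def by (auto intro: span_base)
  moreover assume "\<exists>a b c d. h = a *\<^sub>R e0 + b *\<^sub>R e1 + c *\<^sub>R e2 + d *\<^sub>R e3"
  ultimately show "h \<in> H" unfolding H_def by (auto intro: span_add span_scale)
qed

lemma H_hermitian: "H = {h. conj_transpose h = h}"
proof (rule Set.set_eqI, rule iffI)
  fix h :: cmat2 assume "h \<in> {h. conj_transpose h = h}"
  then have c: "conj_transpose h = h" by simp
  have i: "h$i$j = cnj (h$j$i)" for i j
    using arg_cong[OF c, of "\<lambda>A. A$i$j"] by simp
  have "Im (h$1$1) = 0" "Im (h$2$2) = 0" "Re (h$2$1) = Re (h$1$2)" "Im (h$2$1) = - Im (h$1$2)"
    using arg_cong[OF i[of 1 1], of Im] arg_cong[OF i[of 2 2], of Im]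
      arg_cong[OF i[of 2 1], of Re] arg_cong[OF i[of 2 1], of Im] by simp_all
  then have "h = Re (h$1$1 + h$2$2) *\<^sub>R e0 + (2 * Re (h$1$2)) *\<^sub>R e1
     + (2 * Im (h$1$2)) *\<^sub>R e2 + Re (h$1$1 - h$2$2) *\<^sub>R e3"
    unfolding cmat2_eq_iff complex_eq_iff
    by (simp add: e0_def e1_def e2_def e3_def mat_def add_divide_distrib diff_divide_distrib)
  then show "h \<in> H" unfolding H_sum by blast
next
  fix h :: cmat2 assume "h \<in> H"
  then obtain a b c d where h: "h = a *\<^sub>R e0 + b *\<^sub>R e1 + c *\<^sub>R e2 + d *\<^sub>R e3"
    using H_sum by blast
  have "conj_transpose h = h"
    unfolding h cmat2_eq_iff complex_eq_iff
    by (simp add: e0_def e1_def e2_def e3_def mat_def)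
  then show "h \<in> {h. conj_transpose h = h}" by simp
qed

lemma pairing_det:
  assumes "h \<in> H" shows "complex_of_real (pairing h h) = 4 * det h"
proof -
  obtain a b c d where h: "h = a *\<^sub>R e0 + b *\<^sub>R e1 + c *\<^sub>R e2 + d *\<^sub>R e3"
    using assms H_sum by blast
  show ?thesis
    unfolding pairing_def coord_sum[OF h] det_2
    by (simp add: h e0_def e1_def e2_def e3_def mat_def complex_eq_iff algebra_simps)
qed

end

theory Submission
  imports Defs
begin

text \<open>
  Everything rests on one real-linear map, \<open>X \<mapsto> s X s\<^sup>*\<close>. For \<open>s\<close> in \<open>SU(2)\<close> the adjoint
  \<open>s\<^sup>*\<close> is the inverse of \<open>s\<close>, so this map is at the same time the conjugation by \<open>s\<close> on the
  group, the adjoint action on the Lie algebra, and the natural action on Hermitian forms. As a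
  conjugation it preserves products, determinants and traces; as an action on forms it commutes
  with the conjugate transposition. Hence it preserves the group, both Lie algebras, the space
  of Hermitian matrices and, since the pseudoscalar product is the polarization of \<open>4 det\<close>, that
  product (\<open>pairing_unitary_conj\<close>).

  The isometry property for the antimetric follows: being linear and multiplicative, the map
  takes a horizontal curve \<open>g\<close> with control \<open>u\<close> to the horizontal curve \<open>s g s\<^sup>*\<close> with control
  \<open>s u s\<^sup>*\<close>. It fixes \<open>e0\<close>, so it respects the time orientation, and it preserves the length
  of \<open>u\<close>. The antimetric therefore does not decrease, and by the same argument for the inverse
  of \<open>s\<close> it does not increase either (\<open>antimetric_unitary_conj\<close>).

  Transitivity on the unit sphere of traceless Hermitian matrices is the surjectivity of the Hopf
  map \<open>s \<mapsto> s e3 s\<^sup>*\<close>: an element of the sphere determines the moduli of the entries of \<open>s\<close>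
  through its \<open>e3\<close>-coordinate and their relative phase through the other two (\<open>unit_spacelike_orbit_e3\<close>).
\<close>

section \<open>Stable sets and subgroups\<close>

text \<open>
  The inverse of an element of \<open>I\<close> can be formed in any set of elements between \<open>I\<close> and the
  group, because the product lives in the whole group and inverses there are unique. This
  makes it possible to treat all the groups of automorphisms and isometries below in the same
  way, as parts of an ambient group.
\<close>

lemma (in group) subgroup_of_intermediate:
  assumes I: "subgroup I G" and IJ: "I \<subseteq> J" and J: "J \<subseteq> carrier G"
  shows "subgroup I (G\<lparr>carrier := J\<rparr>)"
proof -
  interpret I: subgroup I G by (rule I)
  have "inv\<^bsub>G\<lparr>carrier := J\<rparr>\<^esub> x = inv x" if x: "x \<in> I" for x
    unfolding m_inv_def[of "G\<lparr>carrier := J\<rparr>"]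
  proof (rule the_equality)
    show "inv x \<in> carrier (G\<lparr>carrier := J\<rparr>) \<and> x \<otimes>\<^bsub>G\<lparr>carrier := J\<rparr>\<^esub> inv x = \<one>\<^bsub>G\<lparr>carrier := J\<rparr>\<^esub> \<and>
      inv x \<otimes>\<^bsub>G\<lparr>carrier := J\<rparr>\<^esub> x = \<one>\<^bsub>G\<lparr>carrier := J\<rparr>\<^esub>"
      using x IJ by auto
    show "y = inv x" if "y \<in> carrier (G\<lparr>carrier := J\<rparr>) \<and>
        x \<otimes>\<^bsub>G\<lparr>carrier := J\<rparr>\<^esub> y = \<one>\<^bsub>G\<lparr>carrier := J\<rparr>\<^esub> \<and> y \<otimes>\<^bsub>G\<lparr>carrier := J\<rparr>\<^esub> x = \<one>\<^bsub>G\<lparr>carrier := J\<rparr>\<^esub>" for y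
      using that x J inv_equality[of y x] by auto
  qed
  then show ?thesis
    using IJ by unfold_locales auto
qed

definition unitary_conj :: "cmat2 \<Rightarrow> cmat2 \<Rightarrow> cmat2" where
  "unitary_conj s X = s ** X ** conj_transpose s"

definition SU2_stable :: "cmat2 set \<Rightarrow> bool" where
  "SU2_stable V \<longleftrightarrow> (\<forall>s\<in>SU2. \<forall>X\<in>V. unitary_conj s X \<in> V)"

lemma SU2_cancel:
  assumes "s \<in> SU2"
  shows "conj_transpose s ** s = mat 1" "s ** conj_transpose s = mat 1"
  using assms matrix_left_right_inverse[of "conj_transpose s" s] by (auto simp: SU2_def)

lemma conj_transpose_SU2: "s \<in> SU2 \<Longrightarrow> conj_transpose s \<in> SU2"
  using subgroup.m_inv_closed[OF subgroup_SU2, of s] subgroup.mem_carrier[OF subgroup_SU2, of s]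
  by (simp add: inv_GLplus matrix_inv_SU2)

lemma mult_SU2: "s \<in> SU2 \<Longrightarrow> t \<in> SU2 \<Longrightarrow> s ** t \<in> SU2"
  using subgroup.m_closed[OF subgroup_SU2, of s t] by (simp add: GLplus_def)

lemma conj_transpose_conj_transpose [simp]: "conj_transpose (conj_transpose A) = A"
  by (simp add: cmat2_eq_iff)

lemma unitary_conj_mult: "unitary_conj (s ** t) X = unitary_conj s (unitary_conj t X)"
  by (simp add: unitary_conj_def conj_transpose_mult matrix_mul_assoc)

lemma unitary_conj_cancel:
  assumes "s \<in> SU2"
  shows "unitary_conj s (unitary_conj (conj_transpose s) X) = X"
    and "unitary_conj (conj_transpose s) (unitary_conj s X) = X"
proof -
  have "unitary_conj (mat 1) X = X"
    by (simp add: unitary_conj_def cmat2_eq_iff matrix_mult_2) (simp add: mat_def)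
  then show "unitary_conj s (unitary_conj (conj_transpose s) X) = X"
    and "unitary_conj (conj_transpose s) (unitary_conj s X) = X"
    using SU2_cancel[OF assms] by (simp_all flip: unitary_conj_mult)
qed

lemma bij_betw_unitary_conj:
  assumes "SU2_stable V" "s \<in> SU2"
  shows "bij_betw (unitary_conj s) V V"
  using assms conj_transpose_SU2 unitary_conj_cancel
  by (intro bij_betwI[where g = "unitary_conj (conj_transpose s)"]) (auto simp: SU2_stable_def)

lemma restrict_unitary_conj_Bij:
  assumes "SU2_stable V" "s \<in> SU2"
  shows "restrict (unitary_conj s) V \<in> Bij V"
  using bij_betw_unitary_conj[OF assms] by (simp add: Bij_def)

text \<open>
  The family \<open>\<phi>\<close> is left free outside \<open>SU2\<close>, so that the conjugations of the group and the
  maps \<open>Ad\<close>, which are written with an inverse instead of an adjoint, are covered as well.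
\<close>

lemma group_action_SU2:
  assumes V: "SU2_stable V" and \<phi>: "\<And>s. s \<in> SU2 \<Longrightarrow> \<phi> s = restrict (unitary_conj s) V"
  shows "group_action SU2_group V \<phi>"
proof -
  have "\<phi> \<in> hom SU2_group (BijGroup V)"
  proof (rule homI)
    show "\<phi> s \<in> carrier (BijGroup V)" if "s \<in> carrier SU2_group" for s
      using that restrict_unitary_conj_Bij[OF V] \<phi> by (simp add: SU2_group_def BijGroup_def)
    fix s t assume "s \<in> carrier SU2_group" "t \<in> carrier SU2_group"
    then have st: "s \<in> SU2" "t \<in> SU2" by (auto simp: SU2_group_def)
    have "\<phi> (s ** t) = compose V (\<phi> s) (\<phi> t)"
      using st V by (auto simp: \<phi> mult_SU2 compose_def unitary_conj_mult SU2_stable_def)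
    then show "\<phi> (s \<otimes>\<^bsub>SU2_group\<^esub> t) = \<phi> s \<otimes>\<^bsub>BijGroup V\<^esub> \<phi> t"
      using restrict_unitary_conj_Bij[OF V] \<phi> st
      by (simp add: BijGroup_def SU2_group_def GLplus_def)
  qed
  then show ?thesis
    by (simp add: group_action_def group_hom_def group_hom_axioms_def group_SU2 group_BijGroup)
qed

lemma subgroup_SU2_image:
  assumes "group_action SU2_group V \<phi>" and "\<phi> ` SU2 \<subseteq> J" and "J \<subseteq> Bij V"
  shows "subgroup (\<phi> ` SU2) (BijGroup V\<lparr>carrier := J\<rparr>)"
proof (rule group.subgroup_of_intermediate[OF group_BijGroup])
  show "subgroup (\<phi> ` SU2) (BijGroup V)"
    using group_hom.img_is_subgroup[OF group_action.group_hom[OF assms(1)]]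
    by (simp add: SU2_group_def)
qed (use assms in \<open>auto simp: BijGroup_def\<close>)

section \<open>Conjugation by a unitary matrix\<close>

lemma linear_unitary_conj: "linear (unitary_conj s)"
  by (rule linearI) (simp_all add: unitary_conj_def cmat2_eq_iff matrix_mult_2 algebra_simps)

lemma unitary_conj_times:
  assumes "s \<in> SU2"
  shows "unitary_conj s (X ** Y) = unitary_conj s X ** unitary_conj s Y"
proof -
  have "unitary_conj s X ** unitary_conj s Y
      = s ** X ** (conj_transpose s ** s) ** Y ** conj_transpose s"
    by (simp only: unitary_conj_def matrix_mul_assoc)
  then show ?thesis
    by (simp add: SU2_cancel[OF assms] unitary_conj_def matrix_mul_assoc)
qed

lemma unitary_conj_lie_bracket:
  assumes "s \<in> SU2"
  shows "unitary_conj s (lie_bracket X Y) = lie_bracket (unitary_conj s X) (unitary_conj s Y)"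
  by (simp add: lie_bracket_def linear_diff[OF linear_unitary_conj] unitary_conj_times[OF assms])

lemma det_unitary_conj: "s \<in> SU2 \<Longrightarrow> det (unitary_conj s X) = det X"
  using conj_transpose_SU2[of s] by (simp add: unitary_conj_def det_mul SU2_def)

lemma trace_unitary_conj: "s \<in> SU2 \<Longrightarrow> trace (unitary_conj s X) = trace X"
  unfolding unitary_conj_def
  by (subst trace_mul_sym) (simp add: matrix_mul_assoc SU2_cancel)

lemma conj_transpose_unitary_conj:
  "conj_transpose (unitary_conj s X) = unitary_conj s (conj_transpose X)"
  by (simp add: unitary_conj_def conj_transpose_mult matrix_mul_assoc)

lemma unitary_conj_e0: "s \<in> SU2 \<Longrightarrow> unitary_conj s e0 = e0"
  by (simp add: e0_def linear_scale[OF linear_unitary_conj])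
    (simp add: unitary_conj_def SU2_cancel)

lemma SU2_stable_GLplus: "SU2_stable (carrier GLplus)"
  by (simp add: SU2_stable_def GLplus_def det_unitary_conj)

lemma SU2_stable_glplus: "SU2_stable glplus"
  by (simp add: SU2_stable_def glplus_def trace_unitary_conj)

lemma SU2_stable_su2: "SU2_stable su2"
  by (simp add: SU2_stable_def su2_def trace_unitary_conj conj_transpose_unitary_conj
      linear_neg[OF linear_unitary_conj])

lemma SU2_stable_H: "SU2_stable H"
  by (simp add: SU2_stable_def H_hermitian conj_transpose_unitary_conj)

lemma unitary_conj_H_iff:
  assumes "s \<in> SU2"
  shows "unitary_conj s X \<in> H \<longleftrightarrow> X \<in> H"
  using SU2_stable_H assms conj_transpose_SU2 unitary_conj_cancel(2)
  unfolding SU2_stable_def by metis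

lemma H_subset_glplus: "H \<subseteq> glplus"
proof
  fix h assume "h \<in> H"
  then have "conj_transpose h = h" by (simp add: H_hermitian)
  then have "cnj (h $ i $ i) = h $ i $ i" for i
    by (metis conj_transpose_nth)
  then show "h \<in> glplus"
    by (simp add: glplus_def trace_def sum_2 Reals_cnj_iff)
qed

lemma H0_iff: "h \<in> H0 \<longleftrightarrow> h \<in> H \<and> trace h = 0"
proof
  assume "h \<in> H0"
  moreover have "e1 \<in> {h. trace h = 0}" "e2 \<in> {h. trace h = 0}" "e3 \<in> {h. trace h = 0}"
    by (simp_all add: trace_def sum_2 e1_def e2_def e3_def)
  moreover have "subspace {h :: cmat2. trace h = 0}"
    by (auto simp: subspace_def trace_def sum_2 algebra_simps simp flip: scaleR_add_right)
  ultimately have "trace h = 0"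
    using span_minimal[of "{e1, e2, e3}" "{h. trace h = 0}"] by (auto simp: H0_def)
  then show "h \<in> H \<and> trace h = 0"
    using \<open>h \<in> H0\<close> span_mono[of "{e1, e2, e3}" "{e0, e1, e2, e3}"] by (auto simp: H_def H0_def)
next
  assume h: "h \<in> H \<and> trace h = 0"
  then obtain a b c d where e: "h = a *\<^sub>R e0 + b *\<^sub>R e1 + c *\<^sub>R e2 + d *\<^sub>R e3"
    using H_sum by blast
  have "a = 0"
    using h by (simp add: e trace_def sum_2 e0_def e1_def e2_def e3_def mat_def complex_eq_iff)
  then show "h \<in> H0"
    by (auto simp: e H0_def intro!: span_add span_scale intro: span_base)
qed

section \<open>Invariance of the pseudoscalar product\<close>

lemma pairing_polarization:
  assumes "h \<in> H" "k \<in> H"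
  shows "2 * pairing h k = pairing (h + k) (h + k) - pairing h h - pairing k k"
proof -
  have "coord (h + k) e = coord h e + coord k e" for e
    using assms unfolding coord_def H_def by (simp add: representation_add H_basis)
  then show ?thesis
    by (simp add: pairing_def algebra_simps)
qed

text \<open>
  Outside \<open>H\<close> all coordinates are \<open>0\<close>, and the complement of \<open>H\<close> is preserved too. The
  invariance of the length of a curve thus holds pointwise, and no exceptional null set enters.
\<close>

lemma pairing_unitary_conj:
  assumes s: "s \<in> SU2"
  shows "pairing (unitary_conj s h) (unitary_conj s k) = pairing h k"
proof (cases "h \<in> H \<and> k \<in> H")
  case True
  have quadratic: "pairing (unitary_conj s x) (unitary_conj s x) = pairing x x" if "x \<in> H" for x
    using that s pairing_det[of x] pairing_det[of "unitary_conj s x"]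
    by (simp add: unitary_conj_H_iff det_unitary_conj flip: of_real_eq_iff[where 'a = complex])
  have "h + k \<in> H" using True unfolding H_def by (auto intro: span_add)
  then show ?thesis
    using True s quadratic pairing_polarization[of h k]
      pairing_polarization[of "unitary_conj s h" "unitary_conj s k"]
    by (simp add: unitary_conj_H_iff flip: linear_add[OF linear_unitary_conj])
next
  case False
  have "coord x e = 0" if "x \<notin> H" for x e
    using that by (simp add: coord_def H_def representation_def)
  then show ?thesis
    using False by (auto simp: pairing_def unitary_conj_H_iff[OF s])
qed

section \<open>Invariance of the antimetric\<close>

lemma horizontal_curve_unitary_conj:
  assumes s: "s \<in> SU2" and g: "horizontal_curve a b g u"
  shows "horizontal_curve a b (\<lambda>t. unitary_conj s (g t)) (\<lambda>t. unitary_conj s (u t))"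
proof -
  have bl: "bounded_linear (unitary_conj s)"
    using linear_unitary_conj by (simp add: linear_conv_bounded_linear)
  obtain C where "C-lipschitz_on {a..b} g"
    using g by (auto simp: horizontal_curve_def)
  moreover obtain B where "B-lipschitz_on (g ` {a..b}) (unitary_conj s)"
    using bounded_linear.lipschitz_boundE[OF bl] .
  ultimately have "(B * C)-lipschitz_on {a..b} (\<lambda>t. unitary_conj s (g t))"
    by (rule lipschitz_on_compose2)
  moreover have "AE t\<in>{a..b} in lebesgue.
      ((\<lambda>t. unitary_conj s (g t)) has_vector_derivative
        unitary_conj s (g t) ** unitary_conj s (u t)) (at t within {a..b}) \<and>
      unitary_conj s (u t) \<in> H"
  proof -
    have "AE t\<in>{a..b} in lebesgue.
        (g has_vector_derivative g t ** u t) (at t within {a..b}) \<and> u t \<in> H"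
      using g by (simp add: horizontal_curve_def)
    then show ?thesis
      by (rule eventually_mono)
        (auto simp: unitary_conj_H_iff[OF s] simp flip: unitary_conj_times[OF s]
          intro: bounded_linear.has_vector_derivative[OF bl])
  qed
  ultimately show ?thesis
    using g s SU2_stable_GLplus by (auto simp: horizontal_curve_def SU2_stable_def)
qed

lemma antimetric_unitary_conj_ge:
  assumes s: "s \<in> SU2"
  shows "antimetric x y \<le> antimetric (unitary_conj s x) (unitary_conj s y)"
  unfolding antimetric_def
proof (rule Sup_subset_mono, clarify)
  fix a b g u
  assume g: "horizontal_curve a b g u" "nonspacelike a b u" "future_directed a b u"
  let ?g = "\<lambda>t. unitary_conj s (g t)" and ?u = "\<lambda>t. unitary_conj s (u t)"
  have "pairing (?u t) e0 = pairing (u t) e0" for t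
    using pairing_unitary_conj[OF s, of _ e0] by (simp add: unitary_conj_e0[OF s])
  then have "horizontal_curve a b ?g ?u" "nonspacelike a b ?u" "future_directed a b ?u"
    "curve_length a b ?u = curve_length a b u"
    using g horizontal_curve_unitary_conj[OF s]
    by (simp_all add: nonspacelike_def future_directed_def curve_length_def
        pairing_unitary_conj[OF s])
  then show "\<exists>a' b' g' u'. ereal (curve_length a b u) = ereal (curve_length a' b' u') \<and>
      horizontal_curve a' b' g' u' \<and> nonspacelike a' b' u' \<and> future_directed a' b' u' \<and>
      g' a' = unitary_conj s (g a) \<and> g' b' = unitary_conj s (g b)"
    by (intro exI[of _ a] exI[of _ b] exI[of _ ?g] exI[of _ ?u]) simp
qed

lemma antimetric_unitary_conj:
  assumes "s \<in> SU2"
  shows "antimetric (unitary_conj s x) (unitary_conj s y) = antimetric x y"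
  using antimetric_unitary_conj_ge[OF assms, of x y]
    antimetric_unitary_conj_ge[OF conj_transpose_SU2[OF assms],
      of "unitary_conj s x" "unitary_conj s y"]
  by (simp add: unitary_conj_cancel[OF assms])

section \<open>Transitivity on the unit sphere\<close>

text \<open>
  The matrix \<open>s\<close> has the first column \<open>(\<alpha>, \<beta>)\<close>, and \<open>s e3 s\<^sup>*\<close> has the coordinates
  \<open>|\<alpha>|\<^sup>2 - |\<beta>|\<^sup>2\<close> along \<open>e3\<close> and \<open>2 \<alpha> cnj \<beta>\<close> in the plane of \<open>e1\<close> and \<open>e2\<close>. Together with
  \<open>|\<alpha>|\<^sup>2 + |\<beta>|\<^sup>2 = 1\<close> the former fixes the moduli; a real \<open>\<alpha>\<close> leaves the phase of the latter
  to \<open>\<beta>\<close>. A phase written with \<open>cis\<close> stays a unit number at the poles, where the plane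
  coordinates vanish.
\<close>

lemma unit_spacelike_orbit_e3:
  assumes "w \<in> unit_spacelike"
  obtains s where "s \<in> SU2" "unitary_conj s e3 = w"
proof -
  have w: "w \<in> H" "trace w = 0" "pairing w w = -1"
    using assms by (auto simp: unit_spacelike_def H0_iff)
  then obtain a b c d where e: "w = a *\<^sub>R e0 + b *\<^sub>R e1 + c *\<^sub>R e2 + d *\<^sub>R e3"
    using H_sum by blast
  have a: "a = 0"
    using w(2) by (simp add: e trace_def sum_2 e0_def e1_def e2_def e3_def mat_def complex_eq_iff)
  have unit: "b\<^sup>2 + c\<^sup>2 + d\<^sup>2 = 1"
    using w(3) by (simp add: pairing_def coord_sum[OF e] a power2_eq_square)
  then have "d\<^sup>2 \<le> 1" by (smt (verit) zero_le_power2)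
  then have d: "-1 \<le> d" "d \<le> 1" by (auto simp: abs_square_le_1 abs_le_iff)
  define z where "z = Complex b c"
  define p where "p = sqrt ((1 + d) / 2)"
  define q where "q = sqrt ((1 - d) / 2)"
  define \<zeta> where "\<zeta> = cis (Arg z)"
  have p2: "p * p = (1 + d) / 2" and q2: "q * q = (1 - d) / 2"
    using d by (auto simp: p_def q_def)
  have "(2 * (p * q))\<^sup>2 = 4 * (p * p) * (q * q)"
    by (simp add: power2_eq_square)
  also have "\<dots> = 1 - d\<^sup>2"
    by (simp add: p2 q2 power2_eq_square field_simps)
  also have "\<dots> = (cmod z)\<^sup>2"
    using unit by (simp add: z_def cmod_power2)
  finally have "2 * (p * q) = cmod z"
    by (rule power2_eq_imp_eq) (use d in \<open>simp_all add: p_def q_def\<close>)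
  then have "complex_of_real (2 * (p * q)) * \<zeta> = z"
    using rcis_cmod_Arg[of z] by (simp add: rcis_def \<zeta>_def)
  then have z: "2 * p * q * Re \<zeta> = b" "2 * p * q * Im \<zeta> = c"
    by (auto simp: z_def complex_eq_iff)
  have zeta: "Re \<zeta> * Re \<zeta> + Im \<zeta> * Im \<zeta> = 1"
    using sin_cos_squared_add3 by (simp add: \<zeta>_def)
  have "q * Re \<zeta> * (q * Re \<zeta>) + q * Im \<zeta> * (q * Im \<zeta>)
      = (q * q) * (Re \<zeta> * Re \<zeta> + Im \<zeta> * Im \<zeta>)"
    by (simp add: algebra_simps)
  then have qz: "q * Re \<zeta> * (q * Re \<zeta>) + q * Im \<zeta> * (q * Im \<zeta>) = (1 - d) / 2"
    by (simp only: zeta q2 mult_1_right)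
  define s where "s = cmat2 p (- of_real q * \<zeta>) (of_real q * cnj \<zeta>) p"
  have "s \<in> SU2"
    using p2 qz
    by (simp add: SU2_def s_def cmat2_eq_iff matrix_mult_2 det_2 complex_eq_iff mat_def)
  moreover have "unitary_conj s e3 = w"
    using p2 qz z
    by (simp add: s_def unitary_conj_def e a cmat2_eq_iff matrix_mult_2 complex_eq_iff
        e1_def e2_def e3_def) (simp add: field_simps)
  ultimately show ?thesis using that by blast
qed

lemma SU2_stable_unit_spacelike: "SU2_stable unit_spacelike"
  by (auto simp: SU2_stable_def unit_spacelike_def H0_iff unitary_conj_H_iff
      trace_unitary_conj pairing_unitary_conj)

lemma SU2_transitive_on_unit_spacelike:
  assumes "x \<in> unit_spacelike" "y \<in> unit_spacelike"
  obtains s where "s \<in> SU2" "unitary_conj s x = y"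
proof -
  obtain r where r: "r \<in> SU2" "unitary_conj r e3 = x"
    using unit_spacelike_orbit_e3[OF assms(1)] .
  obtain t where t: "t \<in> SU2" "unitary_conj t e3 = y"
    using unit_spacelike_orbit_e3[OF assms(2)] .
  show ?thesis
  proof (rule that)
    show "t ** conj_transpose r \<in> SU2"
      using r t by (simp add: mult_SU2 conj_transpose_SU2)
    show "unitary_conj (t ** conj_transpose r) x = y"
      using r t by (auto simp: unitary_conj_mult unitary_conj_cancel)
  qed
qed

section \<open>The two actions\<close>

lemma conjugation_SU2:
  assumes "s \<in> SU2"
  shows "conjugation GLplus s = restrict (unitary_conj s) (carrier GLplus)"
  using assms subgroup.mem_carrier[OF subgroup_SU2 assms]
  by (simp add: conjugation_def unitary_conj_def[abs_def] inv_GLplus matrix_inv_SU2)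
    (simp add: GLplus_def)

lemma Ad_SU2: "s \<in> SU2 \<Longrightarrow> Ad s = restrict (unitary_conj s) glplus"
  by (simp add: Ad_def unitary_conj_def[abs_def] matrix_inv_SU2)

lemma restrict_Ad_SU2:
  assumes "V \<subseteq> glplus" "s \<in> SU2"
  shows "restrict (Ad s) V = restrict (unitary_conj s) V"
  using assms by (auto simp: Ad_SU2 fun_eq_iff restrict_def)

lemma Ad_image_SU2:
  assumes "SU2_stable V" "V \<subseteq> glplus" "s \<in> SU2"
  shows "Ad s ` V = V"
proof -
  have "Ad s ` V = unitary_conj s ` V"
    using assms by (intro image_cong) (auto simp: Ad_SU2)
  then show ?thesis
    using bij_betw_unitary_conj[OF assms(1,3)] by (simp add: bij_betw_def)
qed

lemma restrict_unitary_conj_linear_bijection: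
  assumes V: "SU2_stable V" "subspace V" and s: "s \<in> SU2"
  shows "restrict (unitary_conj s) V \<in> linear_bijections V"
  using V(2) restrict_unitary_conj_Bij[OF V(1) s] linear_unitary_conj[of s]
  by (simp add: linear_bijections_def subspace_add subspace_scale linear_add linear_scale)

lemma subspace_glplus: "subspace glplus"
  by (auto simp: subspace_def glplus_def trace_def sum_2 complex_is_Real_iff algebra_simps
      simp flip: distrib_left)

lemma lie_bracket_glplus: "lie_bracket X Y \<in> glplus"
  by (simp add: lie_bracket_def glplus_def trace_sub trace_mul_sym[of Y X])

lemma subgroup_conjugation_InnGroup: "subgroup (conjugation GLplus ` SU2) (InnGroup GLplus)"
proof -
  interpret group_hom GLplus "AutoGroup GLplus" "conjugation GLplus"
    by (simp add: group_hom_def group_hom_axioms_def group_GLplus group.conjugation_hom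
        group.AutoGroup)
  show ?thesis
    unfolding InnGroup_def
    using subgroup_img_is_subgroup[OF subgroup_SU2] subgroup.subset[OF subgroup_SU2]
    by (intro H.subgroup_of_intermediate) auto
qed

theorem proposition7:
  shows
    "(group_action SU2_group (carrier GLplus) (conjugation GLplus) \<and>
      subgroup (conjugation GLplus ` SU2) (InnGroup GLplus) \<and>
      subgroup (conjugation GLplus ` SU2) (IsomGroup GLplus antimetric)) \<and>
     (group_action SU2_group glplus Ad \<and>
      subgroup (Ad ` SU2) LieAutGroup \<and>
      (\<forall>s\<in>SU2. Ad s ` H = H \<and> Ad s ` su2 = su2) \<and>
      subgroup ((\<lambda>s. restrict (Ad s) H) ` SU2) HIsomGroup \<and>
      transitive_action SU2_group unit_spacelike (\<lambda>s. restrict (Ad s) unit_spacelike))"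
proof (intro conjI ballI)
  show conjugation: "group_action SU2_group (carrier GLplus) (conjugation GLplus)"
    by (rule group_action_SU2[OF SU2_stable_GLplus conjugation_SU2])
  show "subgroup (conjugation GLplus ` SU2) (InnGroup GLplus)"
    by (rule subgroup_conjugation_InnGroup)
  show "subgroup (conjugation GLplus ` SU2) (IsomGroup GLplus antimetric)"
    unfolding IsomGroup_def
    using restrict_unitary_conj_Bij[OF SU2_stable_GLplus]
    by (intro subgroup_SU2_image[OF conjugation]) (auto simp: conjugation_SU2 antimetric_unitary_conj)
  show Ad: "group_action SU2_group glplus Ad"
    by (rule group_action_SU2[OF SU2_stable_glplus Ad_SU2])
  show "subgroup (Ad ` SU2) LieAutGroup"
    unfolding LieAutGroup_def
    using restrict_unitary_conj_linear_bijection[OF SU2_stable_glplus subspace_glplus]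
    by (intro subgroup_SU2_image[OF Ad])
      (auto simp: Ad_SU2 unitary_conj_lie_bracket lie_bracket_glplus linear_bijections_def)
  have su2: "su2 \<subseteq> glplus" by (auto simp: su2_def glplus_def)
  show "Ad s ` H = H" "Ad s ` su2 = su2" if "s \<in> SU2" for s
    using that by (simp_all add: Ad_image_SU2 SU2_stable_H SU2_stable_su2 H_subset_glplus su2)
  have "subspace H" by (simp add: H_def)
  then show "subgroup ((\<lambda>s. restrict (Ad s) H) ` SU2) HIsomGroup"
    unfolding HIsomGroup_def
    using restrict_unitary_conj_linear_bijection[OF SU2_stable_H]
    by (intro subgroup_SU2_image group_action_SU2 SU2_stable_H)
      (auto simp: restrict_Ad_SU2 H_subset_glplus pairing_unitary_conj linear_bijections_def)
  have sphere: "unit_spacelike \<subseteq> glplus"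
    using H_subset_glplus by (auto simp: unit_spacelike_def H0_iff)
  show "transitive_action SU2_group unit_spacelike (\<lambda>s. restrict (Ad s) unit_spacelike)"
  proof (intro transitive_action.intro transitive_action_axioms.intro)
    show "group_action SU2_group unit_spacelike (\<lambda>s. restrict (Ad s) unit_spacelike)"
      by (intro group_action_SU2 SU2_stable_unit_spacelike restrict_Ad_SU2 sphere)
    fix x y assume "x \<in> unit_spacelike" "y \<in> unit_spacelike"
    then obtain s where "s \<in> SU2" "unitary_conj s x = y"
      using SU2_transitive_on_unit_spacelike by blast
    then show "\<exists>s\<in>carrier SU2_group. restrict (Ad s) unit_spacelike x = y"
      using \<open>x \<in> unit_spacelike\<close>
      by (intro bexI[of _ s]) (simp_all add: restrict_Ad_SU2[OF sphere] SU2_group_def)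
  qed
qed

end
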